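(* Let $A\in\mathbb{R}_{\max}^{n\times n}$, $B\in\mathbb{R}_{\max}^{n\times q}$, and let $\mathcal{K}\subset\mathbb{R}_{\max}^n$ be a closed semimodule. Define a sequence of semimodules by $\mathcal{X}_1:=\mathcal{K}$ and $$\mathcal{X}_{k+1}:=\mathcal{K}\cap A^{-1}(\mathcal{X}_k\oplus\operatorname{Im}B)\quad(k\ge 1),$$ and let $\mathcal{K}^\infty:=\bigcap_{k\ge 1}\mathcal{X}_k$. Then $\mathcal{K}^\infty$ is the maximal (i.e. largest) $(A,B)$-controlled invariant semimodule contained in $\mathcal{K}$.
   Context: Max-plus semiring: $\mathbb{R}_{\max}=\mathbb{R}\cup\{-\infty\}$ with addition $a\oplus b=\max(a,b)$ and multiplication $ab=a+b$; the zero is $\varepsilon=-\infty$. Operations extend to matrices as usual: $(E\oplus F)_{ij}=E_{ij}\oplus F_{ij}$, $(EF)_{ij}=\bigoplus_k E_{ik}F_{kj}$. Topology: $\mathbb{R}_{\max}$ has the metric $d(a,b)=|\exp(a)-\exp(b)|$, and $\mathbb{R}_{\max}^n$ the product topology. A semimodule is a (nonempty) subset of $\mathbb{R}_{\max}^n$ stable under all max-plus linear combinations $\lambda x\oplus\mu y$. $\operatorname{Im}B=\{Bu: u\in\mathbb{R}_{\max}^q\}$; $A\mathcal{X}=\{Ax: x\in\mathcal{X}\}$; $A^{-1}\mathcal{S}=\{x: Ax\in\mathcal{S}\}$ (preimage, $A$ need not be invertible); $\mathcal{X}\oplus\mathcal{Y}=\{x\oplus y: x\in\mathcal{X},y\in\mathcal{Y}\}$.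 A semimodule $\mathcal{X}\subset\mathbb{R}_{\max}^n$ is $(A,B)$-controlled invariant if $A\mathcal{X}\subset\mathcal{X}\oplus\operatorname{Im}B$. *)

theory Defs
  imports "HOL-Analysis.Analysis"
begin

text \<open>
  The max-plus semiring, written with the type class operations so that matrices and vectors
  over it are those of \<^theory>\<open>HOL-Analysis.Cartesian_Space\<close>:
  addition is the maximum, multiplication is real addition, \<open>0\<close> is minus infinity and
  \<open>1\<close> is the real number zero.
\<close>

datatype rmax = MInf | Fin real

fun rexp :: "rmax \<Rightarrow> real" where
  "rexp MInf = 0"
| "rexp (Fin x) = exp x"

lemma rexp_inject [simp]: "rexp a = rexp b \<longleftrightarrow> a = b"
  by (cases a; cases b) auto

lemma rexp_nonneg [simp]: "0 \<le> rexp a"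
  by (cases a) auto

instantiation rmax :: linorder
begin

fun less_eq_rmax :: "rmax \<Rightarrow> rmax \<Rightarrow> bool" where
  "MInf \<le> b \<longleftrightarrow> True"
| "Fin x \<le> MInf \<longleftrightarrow> False"
| "Fin x \<le> Fin y \<longleftrightarrow> x \<le> y"

definition less_rmax :: "rmax \<Rightarrow> rmax \<Rightarrow> bool" where
  "a < b \<longleftrightarrow> a \<le> b \<and> \<not> b \<le> (a::rmax)"

lemma less_eq_rmax_iff_rexp: "a \<le> b \<longleftrightarrow> rexp a \<le> rexp b"
  by (cases a; cases b) (auto simp: not_le)

instance
  by standard (auto simp: less_rmax_def less_eq_rmax_iff_rexp)

end

instantiation rmax :: comm_semiring_1
begin

definition zero_rmax :: rmax where "0 = MInf"

definition one_rmax :: rmax where "1 = Fin 0"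

definition plus_rmax :: "rmax \<Rightarrow> rmax \<Rightarrow> rmax" where "a + b = max a (b::rmax)"

fun times_rmax :: "rmax \<Rightarrow> rmax \<Rightarrow> rmax" where
  "Fin x * Fin y = Fin (x + y)"
| "MInf * b = MInf"
| "Fin x * MInf = MInf"

lemma rexp_times: "rexp (a * b) = rexp a * rexp b"
  by (cases a; cases b) (auto simp: exp_add)

lemma rexp_plus: "rexp (a + b) = max (rexp a) (rexp b)"
  by (auto simp: plus_rmax_def max_def less_eq_rmax_iff_rexp)

instance
proof
  fix a b c :: rmax
  show "a * b * c = a * (b * c)" "a * b = b * a" "1 * a = a" "0 * a = 0" "a * 0 = 0"
    by (simp_all flip: rexp_inject add: rexp_times one_rmax_def zero_rmax_def)
  show "a + b + c = a + (b + c)" "a + b = b + a" "0 + a = a"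
    by (simp_all flip: rexp_inject add: rexp_plus zero_rmax_def max.assoc max.commute max_def)
  show "(a + b) * c = a * c + b * c"
    by (simp flip: rexp_inject add: rexp_times rexp_plus max_mult_distrib_right)
  show "(0::rmax) \<noteq> 1"
    by (simp add: zero_rmax_def one_rmax_def)
qed

end

instantiation rmax :: metric_space
begin

definition dist_rmax :: "rmax \<Rightarrow> rmax \<Rightarrow> real" where
  "dist a (b::rmax) = \<bar>rexp a - rexp b\<bar>"

definition uniformity_rmax :: "(rmax \<times> rmax) filter" where
  "uniformity = (INF e\<in>{0<..}. principal {(x, y). dist x (y::rmax) < e})"

definition open_rmax :: "rmax set \<Rightarrow> bool" where
  "open (U :: rmax set) \<longleftrightarrow> (\<forall>x\<in>U. eventually (\<lambda>(x', y). x' = x \<longrightarrow> y \<in> U) uniformity)"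

instance
  by standard (auto simp: dist_rmax_def uniformity_rmax_def open_rmax_def)

end

definition semimodule :: "(rmax ^ 'n) set \<Rightarrow> bool" where
  "semimodule X \<longleftrightarrow> X \<noteq> {} \<and> (\<forall>x\<in>X. \<forall>y\<in>X. \<forall>l m. l *s x + m *s y \<in> X)"

definition Im_mat :: "rmax ^ 'q ^ 'n \<Rightarrow> (rmax ^ 'n) set" where
  "Im_mat B = range (\<lambda>u. B *v u)"

text \<open>The sum of two sets below is the elementwise one of \<^theory>\<open>HOL-Library.Set_Algebras\<close>.\<close>

definition controlled_invariant ::
  "rmax ^ 'n ^ 'n \<Rightarrow> rmax ^ 'q ^ 'n \<Rightarrow> (rmax ^ 'n) set \<Rightarrow> bool" where
  "controlled_invariant A B X \<longleftrightarrow> (\<lambda>x. A *v x) ` X \<subseteq> X + Im_mat B"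

definition largest_controlled_invariant ::
  "rmax ^ 'n ^ 'n \<Rightarrow> rmax ^ 'q ^ 'n \<Rightarrow> (rmax ^ 'n) set \<Rightarrow> (rmax ^ 'n) set \<Rightarrow> bool" where
  "largest_controlled_invariant A B K M \<longleftrightarrow>
     (semimodule M \<and> controlled_invariant A B M \<and> M \<subseteq> K) \<and>
     (\<forall>Y. semimodule Y \<and> controlled_invariant A B Y \<and> Y \<subseteq> K \<longrightarrow> Y \<subseteq> M)"

lemma matrix_vector_lincomb:
  fixes A :: "rmax ^ 'n ^ 'm"
  shows "A *v (l *s x + m *s y) = l *s (A *v x) + m *s (A *v y)"
  by (simp add: vec_eq_iff matrix_vector_mult_def sum_distrib_left sum.distrib algebra_simps)

lemma semimodule_zero:
  assumes "semimodule X" shows "0 \<in> X"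
proof -
  obtain x where "x \<in> X" using assms by (auto simp: semimodule_def)
  then have "0 *s x + 0 *s x \<in> X" using assms unfolding semimodule_def by blast
  then show ?thesis by simp
qed

lemma semimodule_Int:
  assumes "semimodule X" "semimodule Y" shows "semimodule (X \<inter> Y)"
  using assms assms[THEN semimodule_zero] by (auto simp: semimodule_def)

lemma semimodule_Im_mat: "semimodule (Im_mat B)"
  by (auto simp: semimodule_def Im_mat_def simp flip: matrix_vector_lincomb)

lemma semimodule_plus:
  assumes "semimodule X" "semimodule Y" shows "semimodule (X + Y)"
  unfolding semimodule_def
proof (intro conjI ballI allI)
  show "X + Y \<noteq> {}"
    using assms[THEN semimodule_zero] by (auto intro: set_plus_intro)
next
  fix u v l m assume "u \<in> X + Y" "v \<in> X + Y"
  then obtain x y x' y' where *: "u = x + y" "v = x' + y'" "x \<in> X" "y \<in> Y" "x' \<in> X" "y' \<in> Y"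
    by (auto elim!: set_plus_elim)
  then have "l *s u + m *s v = (l *s x + m *s x') + (l *s y + m *s y')"
    by (simp add: vec_eq_iff algebra_simps)
  moreover have "\<dots> \<in> X + Y"
    using * assms by (intro set_plus_intro) (auto simp: semimodule_def)
  ultimately show "l *s u + m *s v \<in> X + Y" by simp
qed

lemma semimodule_vimage:
  fixes A :: "rmax ^ 'n ^ 'm"
  assumes "semimodule S" shows "semimodule ((\<lambda>x. A *v x) -` S)"
proof -
  have "A *v 0 \<in> S"
    using semimodule_zero[OF assms] by (simp add: matrix_vector_mult_def zero_vec_def)
  then have "(\<lambda>x. A *v x) -` S \<noteq> {}" by blast
  then show ?thesis
    using assms by (auto simp: semimodule_def matrix_vector_lincomb)
qed

lemma semimodule_sequence:
  fixes A :: "rmax ^ 'n ^ 'n" and B :: "rmax ^ 'q ^ 'n" and X :: "nat \<Rightarrow> (rmax ^ 'n) set"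
  assumes "semimodule K" "X 1 = K"
    and "\<And>k. k \<ge> 1 \<Longrightarrow> X (k + 1) = K \<inter> (\<lambda>x. A *v x) -` (X k + Im_mat B)"
    and "k \<ge> 1"
  shows "semimodule (X k)"
  using \<open>k \<ge> 1\<close>
proof (induction k rule: nat_induct_at_least)
  case base
  then show ?case using assms by simp
next
  case (Suc k)
  then show ?case
    using assms(1) assms(3)[of k]
    by (simp add: semimodule_Int semimodule_vimage semimodule_plus semimodule_Im_mat)
qed

end

theory Submission
  imports Defs
begin

text \<open>
  A closed set \<open>S\<close> of vectors is determined by its intersections with the order boxes \<open>{..s}\<close>,
  and these are compact because every vector is bounded below by \<open>0\<close>. Since \<open>x + y \<le> s\<close> holds
  exactly if \<open>x \<le> s\<close> and \<open>y \<le> s\<close>, sums of closed sets are closed, so all \<open>X k\<close> are closed.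
  If \<open>x\<close> lies in every \<open>X k\<close>, then the decompositions of \<open>A *v x\<close> in \<open>X k + Im_mat B\<close> form a
  decreasing sequence of nonempty compact sets; a common point gives a decomposition in
  \<open>(\<Inter>k. X k) + Im_mat B\<close>.
\<close>

section \<open>Topology of the max-plus numbers, transferred along the isometry
  \<open>rexp\<close>\<close>

lemma tendsto_rexp_iff: "((\<lambda>x. rexp (f x)) \<longlongrightarrow> rexp l) F \<longleftrightarrow> (f \<longlongrightarrow> l) F"
  by (simp add: tendsto_dist_iff[of f] tendsto_dist_iff[of "\<lambda>x. rexp (f x)"]
      dist_rmax_def dist_real_def)

instance rmax :: topological_comm_monoid_add
proof
  fix a b :: rmax
  have "((\<lambda>x. rexp (fst x)) \<longlongrightarrow> rexp a) (nhds a \<times>\<^sub>F nhds b)"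
    "((\<lambda>x. rexp (snd x)) \<longlongrightarrow> rexp b) (nhds a \<times>\<^sub>F nhds b)"
    by (simp_all add: tendsto_rexp_iff filterlim_fst filterlim_snd)
  then show "((\<lambda>x. fst x + snd x) \<longlongrightarrow> a + b) (nhds a \<times>\<^sub>F nhds b)"
    unfolding tendsto_rexp_iff[symmetric] rexp_plus by (rule tendsto_max)
qed

instance rmax :: topological_semigroup_mult
proof
  fix a b :: rmax
  have "((\<lambda>x. rexp (fst x)) \<longlongrightarrow> rexp a) (nhds a \<times>\<^sub>F nhds b)"
    "((\<lambda>x. rexp (snd x)) \<longlongrightarrow> rexp b) (nhds a \<times>\<^sub>F nhds b)"
    by (simp_all add: tendsto_rexp_iff filterlim_fst filterlim_snd)
  then show "((\<lambda>x. fst x * snd x) \<longlongrightarrow> a * b) (nhds a \<times>\<^sub>F nhds b)"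
    unfolding tendsto_rexp_iff[symmetric] rexp_times by (rule tendsto_mult)
qed

text \<open>A left inverse of \<open>rexp\<close>, sending all negative reals to
  \<open>MInf\<close>: this makes it total and, as \<open>rexp (rlog r) = max 0 r\<close>,
  continuous on the whole real line.\<close>

definition rlog :: "real \<Rightarrow> rmax" where
  "rlog r = (if r \<le> 0 then MInf else Fin (ln r))"

lemma rexp_rlog [simp]: "rexp (rlog r) = max 0 r"
  by (simp add: rlog_def)

lemma rlog_rexp [simp]: "rlog (rexp a) = a"
  by (simp flip: rexp_inject)

lemma continuous_on_rlog: "continuous_on S rlog"
  by (auto simp: continuous_on_def simp flip: tendsto_rexp_iff intro!: tendsto_intros)

instance rmax :: heine_borel
proof
  fix f :: "nat \<Rightarrow> rmax"
  assume "bounded (range f)"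
  then have "bounded (range (\<lambda>n. rexp (f n)))"
    unfolding bounded_def by (force simp: dist_rmax_def dist_real_def)
  then obtain l r where r: "strict_mono r" "((\<lambda>n. rexp (f n)) \<circ> r) \<longlonglongrightarrow> l"
    using bounded_imp_convergent_subsequence[of "\<lambda>n. rexp (f n)"] by blast
  then have "(\<lambda>n. rlog (rexp (f (r n)))) \<longlonglongrightarrow> rlog l"
    using continuous_on_tendsto_compose[OF continuous_on_rlog[of UNIV] r(2)] by (simp add: o_def)
  then show "\<exists>l r. strict_mono (r :: nat \<Rightarrow> nat) \<and> (f \<circ> r) \<longlonglongrightarrow> l"
    using r(1) by (auto simp: o_def)
qed

section \<open>Order boxes and their compactness\<close>

lemma rmax_add_le_iff: "a + b \<le> c \<longleftrightarrow> a \<le> c \<and> b \<le> (c::rmax)"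
  by (simp add: plus_rmax_def)

lemma rmax_zero_le [simp]: "0 \<le> (a::rmax)"
  by (simp add: zero_rmax_def)

lemma vec_add_le_iff: "x + y \<le> s \<longleftrightarrow> x \<le> s \<and> y \<le> (s :: rmax ^ 'n)"
  by (auto simp: less_eq_vec_def rmax_add_le_iff)

lemma rmax_sum_le_iff:
  assumes "finite I"
  shows "sum f I \<le> c \<longleftrightarrow> (\<forall>i\<in>I. f i \<le> (c::rmax))"
  using assms by induction (auto simp: rmax_add_le_iff)

text \<open>In exponential coordinates the box is a real box with lower corner 0, and coordinatewise
  \<open>rlog\<close> carries it back continuously.\<close>

lemma compact_atMost_rmax_vec: "compact {..s :: rmax ^ 'n}"
proof -
  let ?g = "\<lambda>v :: real ^ 'n. \<chi> i. rlog (v $ i)"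
  have "continuous_on UNIV ?g"
    by (intro continuous_on_vec_lambda continuous_on_compose2[OF continuous_on_rlog[of UNIV]]
        continuous_intros) auto
  then have "compact (?g ` cbox 0 (\<chi> i. rexp (s $ i)))"
    by (intro compact_continuous_image compact_cbox) (auto intro: continuous_on_subset)
  moreover have "?g ` cbox 0 (\<chi> i. rexp (s $ i)) = {..s}"
  proof safe
    fix v :: "real ^ 'n" assume "v \<in> cbox 0 (\<chi> i. rexp (s $ i))"
    then show "?g v \<le> s"
      by (auto simp: less_eq_vec_def less_eq_rmax_iff_rexp mem_box_cart)
  next
    fix x assume "x \<le> s"
    then show "x \<in> ?g ` cbox 0 (\<chi> i. rexp (s $ i))"
      by (intro image_eqI[of _ _ "\<chi> i. rexp (x $ i)"])
        (auto simp: less_eq_vec_def less_eq_rmax_iff_rexp mem_box_cart vec_eq_iff)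
  qed
  ultimately show ?thesis by simp
qed

text \<open>A convergent sequence eventually stays in a single box, so its limit can be tested
  there.\<close>

lemma closed_if_closed_boxes:
  fixes S :: "(rmax ^ 'n) set"
  assumes "\<And>s. closed (S \<inter> {..s})"
  shows "closed S"
  unfolding closed_sequential_limits
proof safe
  fix f l assume f: "\<forall>n. f n \<in> S" "f \<longlonglongrightarrow> l"
  \<comment> \<open>Raising each coordinate by 1 on the exponential scale gives a box containing the
    open unit ball around \<open>l\<close>.\<close>
  define s where "s = (\<chi> i. rlog (rexp (l $ i) + 1))"
  have "x \<le> s" if "dist x l < 1" for x
  proof -
    have "rexp (x $ i) \<le> rexp (l $ i) + 1" for i
      using order.strict_trans1[OF dist_vec_nth_le[of x i l] that] by (simp add: dist_rmax_def)
    then show ?thesis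
      by (auto simp: s_def less_eq_vec_def less_eq_rmax_iff_rexp le_max_iff_disj)
  qed
  moreover have "\<forall>\<^sub>F n in sequentially. dist (f n) l < 1"
    using f(2) by (rule tendstoD) simp
  ultimately have "\<forall>\<^sub>F n in sequentially. f n \<in> S \<inter> {..s}"
    using f(1) by (auto elim: eventually_mono)
  then have "l \<in> S \<inter> {..s}"
    using assms f(2) by (intro Lim_in_closed_set[of _ f]) auto
  then show "l \<in> S" by simp
qed

lemma compact_Int_atMost_rmax_vec: "closed S \<Longrightarrow> compact (S \<inter> {..s :: rmax ^ 'n})"
  by (rule closed_Int_compact[OF _ compact_atMost_rmax_vec])

section \<open>Closedness of sums, preimages and images of matrices\<close>

lemma continuous_on_rmax_vec_add:
  fixes f g :: "'a::topological_space \<Rightarrow> rmax ^ 'n"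
  assumes "continuous_on S f" "continuous_on S g"
  shows "continuous_on S (\<lambda>x. f x + g x)"
  unfolding plus_vec_def using assms by (intro continuous_intros)

lemma closed_plus:
  fixes S T :: "(rmax ^ 'n) set"
  assumes "closed S" "closed T"
  shows "closed (S + T)"
proof (rule closed_if_closed_boxes)
  fix s :: "rmax ^ 'n"
  have "(S + T) \<inter> {..s} = (\<lambda>p. fst p + snd p) ` ((S \<inter> {..s}) \<times> (T \<inter> {..s}))"
    by (force simp: set_plus_def vec_add_le_iff image_iff)
  moreover have "compact \<dots>"
    by (intro compact_continuous_image continuous_on_rmax_vec_add continuous_intros
        compact_Times compact_Int_atMost_rmax_vec assms)
  ultimately show "closed ((S + T) \<inter> {..s})"
    by (simp add: compact_imp_closed)
qed

lemma continuous_on_rmax_matrix_vector_mult: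
  fixes A :: "rmax ^ 'n ^ 'm"
  shows "continuous_on S (\<lambda>x. A *v x)"
  unfolding matrix_vector_mult_def by (intro continuous_intros)

lemma closed_vimage_rmax_matrix:
  fixes A :: "rmax ^ 'n ^ 'm"
  assumes "closed S"
  shows "closed ((\<lambda>x. A *v x) -` S)"
  by (rule closed_vimage[OF assms continuous_on_rmax_matrix_vector_mult])

text \<open>
  Coordinates of \<open>u\<close> that meet a zero column of \<open>B\<close> are unconstrained by \<open>B *v u \<le> s\<close>; they are
  reset to \<open>0\<close>. All other coordinates are bounded by residuation.
\<close>
lemma closed_Im_mat:
  fixes B :: "rmax ^ 'q ^ 'n"
  shows "closed (Im_mat B)"
proof (rule closed_if_closed_boxes)
  fix s :: "rmax ^ 'n"
  \<comment> \<open>\<open>r j\<close> selects a row with a nonzero entry in column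
    \<open>j\<close>, whenever that column has one.\<close>
  have "\<exists>r. \<forall>j k. B $ k $ j \<noteq> 0 \<longrightarrow> B $ r j $ j \<noteq> 0"
    by (intro choice) blast
  then obtain r where r: "\<And>i j. B $ i $ j \<noteq> 0 \<Longrightarrow> B $ r j $ j \<noteq> 0"
    by blast
  \<comment> \<open>The max-plus quotient of \<open>s $ r j\<close> by \<open>B $ r j $ j\<close>.
    For a zero column the real division by 0 yields 0, so the bound is \<open>MInf\<close>, which
    the reset coordinate meets.\<close>
  define t where "t = (\<chi> j. rlog (rexp (s $ r j) / rexp (B $ r j $ j)))"
  let ?C = "((\<lambda>u. B *v u) -` {..s}) \<inter> {..t}"
  have "Im_mat B \<inter> {..s} = (\<lambda>u. B *v u) ` ?C"
  proof safe
    fix b assume "b \<in> Im_mat B" "b \<le> s"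
    then obtain u where u: "b = B *v u" "B *v u \<le> s"
      by (auto simp: Im_mat_def)
    define v where "v = (\<chi> j. if B $ r j $ j = 0 then 0 else u $ j)"
    have "B $ i $ j * v $ j = B $ i $ j * u $ j" for i j
      using r[of i j] by (cases "B $ i $ j = 0") (auto simp: v_def)
    then have v: "B *v v = B *v u"
      by (simp add: matrix_vector_mult_def)
    have "v $ j \<le> t $ j" for j
    proof (cases "B $ r j $ j = 0")
      case False
      then have "0 < rexp (B $ r j $ j)"
        by (cases "B $ r j $ j") (auto simp: zero_rmax_def)
      moreover have "B $ r j $ j * u $ j \<le> s $ r j"
        using u(2) by (simp add: less_eq_vec_def matrix_vector_mult_def rmax_sum_le_iff)
      ultimately show ?thesis
        using False
        by (simp add: t_def v_def less_eq_rmax_iff_rexp rexp_times field_simps le_max_iff_disj)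
    qed (simp add: v_def)
    then show "b \<in> (\<lambda>u. B *v u) ` ?C"
      using u v by (intro image_eqI[of _ _ v]) (auto simp: less_eq_vec_def)
  qed (auto simp: Im_mat_def)
  moreover have "compact ((\<lambda>u. B *v u) ` ?C)"
    by (intro compact_continuous_image continuous_on_rmax_matrix_vector_mult
        compact_Int_atMost_rmax_vec closed_vimage_rmax_matrix
        compact_imp_closed[OF compact_atMost_rmax_vec])
  ultimately show "closed (Im_mat B \<inter> {..s})"
    by (simp add: compact_imp_closed)
qed

section \<open>Intersections of decreasing sequences and the largest invariant semimodule\<close>

lemma INT_plus_closed:
  fixes X :: "nat \<Rightarrow> (rmax ^ 'n) set"
  assumes "\<And>k. closed (X k)" "decseq X" "closed T" and s: "\<And>k. s \<in> X k + T"
  shows "s \<in> (\<Inter>k. X k) + T"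
proof -
  \<comment> \<open>Keeping both summands as a pair lets a common point serve as one decomposition
    for all \<open>k\<close>. The boxes give compactness and lose nothing, since summands of
    \<open>s\<close> lie below \<open>s\<close>.\<close>
  define C where "C k = (\<lambda>p. fst p + snd p) -` {s} \<inter> ((X k \<inter> {..s}) \<times> (T \<inter> {..s}))" for k
  have "compact (C k)" for k
    unfolding C_def
    by (intro closed_Int_compact closed_vimage compact_Times compact_Int_atMost_rmax_vec assms
        continuous_on_rmax_vec_add continuous_intros closed_singleton)
  moreover have "C k \<noteq> {}" for k
  proof -
    obtain x y where "x \<in> X k" "y \<in> T" "s = x + y"
      using s[of k] by (auto elim: set_plus_elim)
    then have "(x, y) \<in> C k"
      using vec_add_le_iff[of x y s] by (auto simp: C_def)
    then show ?thesis by blast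
  qed
  moreover have "C n \<subseteq> C m" if "m \<le> n" for m n
    using decseqD[OF \<open>decseq X\<close> that] by (auto simp: C_def)
  ultimately have "(\<Inter>k. C k) \<noteq> {}"
    by (rule compact_nest)
  then obtain x y where "\<And>k. (x, y) \<in> C k" by auto
  then have "x \<in> (\<Inter>k. X k)" "y \<in> T" "s = x + y"
    by (auto simp: C_def)
  then show ?thesis by (auto intro: set_plus_intro)
qed

lemma semimodule_INT:
  assumes "\<And>k. k \<in> I \<Longrightarrow> semimodule (X k)"
  shows "semimodule (\<Inter>k\<in>I. X k)"
  unfolding semimodule_def
proof (intro conjI ballI allI)
  have "0 \<in> (\<Inter>k\<in>I. X k)"
    using assms by (auto intro: semimodule_zero)
  then show "(\<Inter>k\<in>I. X k) \<noteq> {}"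
    by (metis empty_iff)
next
  fix x y l m assume "x \<in> (\<Inter>k\<in>I. X k)" "y \<in> (\<Inter>k\<in>I. X k)"
  then show "l *s x + m *s y \<in> (\<Inter>k\<in>I. X k)"
    using assms by (auto simp: semimodule_def)
qed

theorem proposition3:
  fixes A :: "rmax ^ 'n ^ 'n" and B :: "rmax ^ 'q ^ 'n"
    and K :: "(rmax ^ 'n) set" and X :: "nat \<Rightarrow> (rmax ^ 'n) set"
  assumes "semimodule K" and "closed K"
    and "X 1 = K"
    and "\<And>k. k \<ge> 1 \<Longrightarrow> X (k + 1) = K \<inter> (\<lambda>x. A *v x) -` (X k + Im_mat B)"
  shows "largest_controlled_invariant A B K (\<Inter>k\<in>{1..}. X k)"
proof -
  \<comment> \<open>Shifting the index to start at 0 allows plain induction and intersections over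
    all naturals.\<close>
  define Z where "Z k = X (Suc k)" for k
  have Z_0: "Z 0 = K"
    using assms(3) by (simp add: Z_def)
  have Z_Suc: "Z (Suc k) = K \<inter> (\<lambda>x. A *v x) -` (Z k + Im_mat B)" for k
    using assms(4)[of "Suc k"] by (simp add: Z_def)
  have INT_eq: "(\<Inter>k\<in>{1..}. X k) = (\<Inter>k. Z k)"
  proof -
    have "{1..} = range Suc"
      by (auto simp: image_iff Suc_le_eq gr0_conv_Suc)
    then show ?thesis by (simp add: Z_def image_image)
  qed
  have "closed (Z k)" for k
    by (induction k) (auto simp: Z_0 Z_Suc intro!: closed_Int closed_vimage_rmax_matrix
        closed_plus closed_Im_mat assms(2))
  moreover have "decseq Z"
  proof (rule decseq_SucI)
    \<comment> \<open>The map from \<open>S\<close> to \<open>K\<close> intersected with the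
      preimage of \<open>S + Im_mat B\<close> is monotone, so the first inclusion
      propagates.\<close>
    show "Z (Suc k) \<subseteq> Z k" for k
    proof (induction k)
      case (Suc k)
      then have "Z (Suc k) + Im_mat B \<subseteq> Z k + Im_mat B"
        by (intro set_plus_mono2) auto
      then show ?case
        unfolding Z_Suc[of "Suc k"] Z_Suc[of k] by blast
    qed (simp add: Z_0 Z_Suc)
  qed
  \<comment> \<open>Membership in \<open>Z (Suc k)\<close> supplies a decomposition at level
    \<open>k\<close>; \<open>INT_plus_closed\<close> turns these into one valid at all
    levels.\<close>
  moreover have "A *v x \<in> Z k + Im_mat B" if "x \<in> (\<Inter>k. Z k)" for x k
    using that Z_Suc[of k] by blast
  ultimately have "controlled_invariant A B (\<Inter>k. Z k)"
    unfolding controlled_invariant_def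
    by (auto intro!: INT_plus_closed closed_Im_mat)
  moreover have "semimodule (\<Inter>k\<in>{1..}. X k)"
    using semimodule_sequence[OF assms(1,3,4)] by (intro semimodule_INT) simp
  moreover have "(\<Inter>k. Z k) \<subseteq> K"
    using Z_0 by blast
  \<comment> \<open>Maximality: if \<open>Y\<close> lies in \<open>Z k\<close>, invariance sends
    \<open>Y\<close> into \<open>Y + Im_mat B\<close>, hence into \<open>Z k + Im_mat B\<close>, so
    \<open>Y\<close> lies in the next iterate.\<close>
  moreover have "Y \<subseteq> Z k" if "controlled_invariant A B Y" "Y \<subseteq> K" for Y k
  proof (induction k)
    case (Suc k)
    then have "Y + Im_mat B \<subseteq> Z k + Im_mat B"
      by (intro set_plus_mono2) auto
    then show ?case
      using that unfolding Z_Suc controlled_invariant_def by blast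
  qed (simp add: Z_0 that)
  ultimately show ?thesis
    unfolding largest_controlled_invariant_def INT_eq by blast
qed

end
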